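(* Consider the binary random graph affiliation mixture model with $Q\ge 2$ groups, on $Q+1$ nodes. Let $$U_Q(X)=\mathbb E\Big(\prod_{1\le i<j\le Q+1}(X-X_{ij})\Big),$$ a univariate polynomial of degree $\binom{Q+1}2$ in an indeterminate $X$ (expectation taken coefficientwise), and $$V_Q(X,Y)=\mathbb E\Big(\Big(X+(Q-1)Y-\sum_{1\le i\le Q}X_{i(Q+1)}\Big)\prod_{1\le i<j\le Q}(X-X_{ij})\Big),$$ of degree $\binom Q2+1$ in $X$ and degree $1$ in $Y$. Then $U_Q(\alpha)=0$ (so $\alpha$ is a real root of $U_Q$), $V_Q(\alpha,\beta)=0$, and the coefficient of $Y$ in $V_Q(\alpha,Y)$ is non-zero if and only if $\alpha\ne\beta$.
   Context: Random graph mixture model: nodes have i.i.d. latent groups $Z_i\in\{1,\dots,Q\}$ with $\pi_q=\mathbb P(Z_i=q)\in(0,1)$, $\sum_q\pi_q=1$; edge variables $X_{ij}$ ($i<j$) are conditionally independent given all $Z$'s, with law of $X_{ij}$ depending only on $(Z_i,Z_j)$. Binary affiliation model: $X_{ij}\in\{0,1\}$ with $\mathbb P(X_{ij}=1\mid Z_i=q,Z_j=l)=\alpha$ if $q=l$ and $=\beta$ if $q\ne l$. *)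

theory Defs
  imports "HOL-Computational_Algebra.Polynomial" "HOL-Library.FuncSet"
begin

text \<open>Nodes are 1..n, groups are 1..Q. Edge variables are indexed by pairs (i,j) with
  1 \<le> i < j \<le> n.\<close>

definition aff_edges :: "nat \<Rightarrow> (nat \<times> nat) set" where
  "aff_edges n = {(i, j). 1 \<le> i \<and> i < j \<and> j \<le> n}"

text \<open>Joint probability of the latent assignment z and the edge configuration x in the
  binary affiliation model: P(Z = z) * P(X = x | Z = z).\<close>

definition aff_weight ::
  "nat \<Rightarrow> (nat \<Rightarrow> real) \<Rightarrow> real \<Rightarrow> real \<Rightarrow> (nat \<Rightarrow> nat) \<Rightarrow> (nat \<times> nat \<Rightarrow> real) \<Rightarrow> real" where
  "aff_weight n \<pi> \<alpha> \<beta> z x =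
     (\<Prod>i\<in>{1..n}. \<pi> (z i)) *
     (\<Prod>e\<in>aff_edges n.
        (let p = (if z (fst e) = z (snd e) then \<alpha> else \<beta>)
         in if x e = 1 then p else 1 - p))"

text \<open>Expectation of a function f of the edge variables (values in a ring 'b into which the
  reals embed via emb; used coefficientwise for polynomials).\<close>

definition aff_expect ::
  "nat \<Rightarrow> nat \<Rightarrow> (nat \<Rightarrow> real) \<Rightarrow> real \<Rightarrow> real \<Rightarrow> (real \<Rightarrow> 'b::comm_ring_1)
     \<Rightarrow> ((nat \<times> nat \<Rightarrow> real) \<Rightarrow> 'b) \<Rightarrow> 'b" where
  "aff_expect Q n \<pi> \<alpha> \<beta> emb f =
     (\<Sum>z\<in>{1..n} \<rightarrow>\<^sub>E {1..Q}. \<Sum>x\<in>aff_edges n \<rightarrow>\<^sub>E {0, 1}.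
        emb (aff_weight n \<pi> \<alpha> \<beta> z x) * f x)"

definition U_poly :: "nat \<Rightarrow> (nat \<Rightarrow> real) \<Rightarrow> real \<Rightarrow> real \<Rightarrow> real poly" where
  "U_poly Q \<pi> \<alpha> \<beta> =
     aff_expect Q (Q + 1) \<pi> \<alpha> \<beta> (\<lambda>r. [:r:])
       (\<lambda>x. \<Prod>e\<in>aff_edges (Q + 1). [:- x e, 1:])"

text \<open>V_Q(X,Y) as a polynomial in X whose coefficients are real polynomials in Y:
  E((X + (Q-1) Y - sum_{i \<le> Q} X_{i,Q+1}) prod_{1 \<le> i<j \<le> Q} (X - X_ij)).\<close>

definition V_poly :: "nat \<Rightarrow> (nat \<Rightarrow> real) \<Rightarrow> real \<Rightarrow> real \<Rightarrow> real poly poly" where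
  "V_poly Q \<pi> \<alpha> \<beta> =
     aff_expect Q (Q + 1) \<pi> \<alpha> \<beta> (\<lambda>r. [:[:r:]:])
       (\<lambda>x. [: [: - (\<Sum>i=1..Q. x (i, Q + 1)), real Q - 1 :], 1 :] *
            (\<Prod>e\<in>aff_edges Q. [: [: - x e :], 1 :]))"

definition V_at :: "real poly poly \<Rightarrow> real \<Rightarrow> real poly" where
  "V_at V a = poly V [:a:]"

end

theory Submission
  imports Defs
begin

(* Condition on the latent groups z.  Given z the edge variables are independent
   Bernoulli variables with parameter edge_prob z e (alpha inside a group, beta across groups),
   so the conditional expectation of a product of functions of distinct edges is the product
   of the one-edge expectations (cond_expect_prod); in particular E(a - X_e | z) = a - p_e.
   - U: with Q+1 nodes and Q groups some edge is monochromatic (pigeonhole), so the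
     factor alpha - p_e of that edge vanishes and E(U_Q(alpha) | z) = 0 for every z.
   - V: the factor prod_{i<j<=Q}(alpha - p_ij) vanishes unless z is injective on {1..Q}; then
     z is a bijection onto the groups, node Q+1 shares its group with exactly one i <= Q, and
     sum_i p_{i,Q+1} = alpha + (Q-1) beta, which cancels the linear factor.
   - The coefficient of Y is (Q-1)(alpha-beta)^(Q choose 2) P(z injective on {1..Q}), and
     that probability is positive. *)

section \<open>Evaluating polynomial-valued expectations\<close>

text \<open>Expectation commutes with evaluation and with taking coefficients, since both are
  linear and the embedding of the reals is by constant polynomials.\<close>

lemma poly_aff_expect:
  fixes emb :: "real \<Rightarrow> 'b::comm_ring_1"
  shows "poly (aff_expect Q n \<pi> \<alpha> \<beta> (\<lambda>r. [:emb r:]) f) a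
         = aff_expect Q n \<pi> \<alpha> \<beta> emb (\<lambda>x. poly (f x) a)"
  by (simp add: aff_expect_def poly_sum)

lemma coeff_aff_expect:
  fixes emb :: "real \<Rightarrow> 'b::comm_ring_1"
  shows "coeff (aff_expect Q n \<pi> \<alpha> \<beta> (\<lambda>r. [:emb r:]) f) k
         = aff_expect Q n \<pi> \<alpha> \<beta> emb (\<lambda>x. coeff (f x) k)"
  by (simp add: aff_expect_def coeff_sum)

lemma U_eval:
  "poly (U_poly Q \<pi> \<alpha> \<beta>) \<alpha>
   = aff_expect Q (Q + 1) \<pi> \<alpha> \<beta> (\<lambda>r. r) (\<lambda>x. \<Prod>e\<in>aff_edges (Q + 1). \<alpha> - x e)"
  by (simp add: U_poly_def poly_aff_expect poly_prod)

lemma V_at_alpha_integrand: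
  "poly ([: [: - S, real Q - 1 :], 1 :] * (\<Prod>e\<in>A. [: [: - x e :], 1 :])) [:a:]
   = [: a - S, real Q - 1 :] * [: \<Prod>e\<in>A. a - x e :]"
  by (simp add: poly_prod prod_to_poly algebra_simps)

lemma V_eval:
  "poly (V_at (V_poly Q \<pi> \<alpha> \<beta>) \<alpha>) \<beta>
   = aff_expect Q (Q + 1) \<pi> \<alpha> \<beta> (\<lambda>r. r)
       (\<lambda>x. (\<alpha> + (real Q - 1) * \<beta> - (\<Sum>i=1..Q. x (i, Q + 1))) * (\<Prod>e\<in>aff_edges Q. \<alpha> - x e))"
  unfolding V_at_def V_poly_def poly_aff_expect V_at_alpha_integrand
  by (simp add: algebra_simps)

lemma V_coeff_eval:
  "coeff (V_at (V_poly Q \<pi> \<alpha> \<beta>) \<alpha>) 1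
   = aff_expect Q (Q + 1) \<pi> \<alpha> \<beta> (\<lambda>r. r) (\<lambda>x. (real Q - 1) * (\<Prod>e\<in>aff_edges Q. \<alpha> - x e))"
  unfolding V_at_def V_poly_def poly_aff_expect coeff_aff_expect V_at_alpha_integrand
  by (simp add: mult.commute)

section \<open>Conditioning on the latent groups\<close>

definition edge_prob :: "real \<Rightarrow> real \<Rightarrow> (nat \<Rightarrow> nat) \<Rightarrow> nat \<times> nat \<Rightarrow> real" where
  "edge_prob \<alpha> \<beta> z e = (if z (fst e) = z (snd e) then \<alpha> else \<beta>)"

definition bernoulli_weight :: "real \<Rightarrow> real \<Rightarrow> real" where
  "bernoulli_weight p s = (if s = 1 then p else 1 - p)"

definition prior :: "nat \<Rightarrow> (nat \<Rightarrow> real) \<Rightarrow> (nat \<Rightarrow> nat) \<Rightarrow> real" where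
  "prior n \<pi> z = (\<Prod>i\<in>{1..n}. \<pi> (z i))"

definition cond_expect ::
  "nat \<Rightarrow> real \<Rightarrow> real \<Rightarrow> (nat \<Rightarrow> nat) \<Rightarrow> ((nat \<times> nat \<Rightarrow> real) \<Rightarrow> real) \<Rightarrow> real" where
  "cond_expect n \<alpha> \<beta> z f =
     (\<Sum>x\<in>aff_edges n \<rightarrow>\<^sub>E {0, 1}.
        (\<Prod>e\<in>aff_edges n. bernoulli_weight (edge_prob \<alpha> \<beta> z e) (x e)) * f x)"

lemma finite_aff_edges: "finite (aff_edges n)"
  by (rule finite_subset[of _ "{1..n} \<times> {1..n}"]) (auto simp: aff_edges_def)

lemma aff_expect_conditioning:
  "aff_expect Q n \<pi> \<alpha> \<beta> (\<lambda>r. r) f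
   = (\<Sum>z\<in>{1..n} \<rightarrow>\<^sub>E {1..Q}. prior n \<pi> z * cond_expect n \<alpha> \<beta> z f)"
  by (simp add: aff_expect_def aff_weight_def cond_expect_def prior_def edge_prob_def
      bernoulli_weight_def Let_def sum_distrib_left mult.assoc)

lemma bernoulli_expect_prod:
  fixes p :: "'e \<Rightarrow> real" and h :: "'e \<Rightarrow> real \<Rightarrow> real"
  assumes "finite D" and "A \<subseteq> D"
  shows "(\<Sum>x\<in>D \<rightarrow>\<^sub>E {0, 1}. (\<Prod>e\<in>D. bernoulli_weight (p e) (x e)) * (\<Prod>e\<in>A. h e (x e)))
         = (\<Prod>e\<in>A. (1 - p e) * h e 0 + p e * h e 1)"
proof -
  define g where "g e s = (if e \<in> A then h e s else 1)" for e s
  have DA: "D \<inter> A = A" using assms(2) by blast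
  have restrict: "(\<Prod>e\<in>A. k e) = (\<Prod>e\<in>D. if e \<in> A then k e else 1)" for k :: "'e \<Rightarrow> real"
    using prod.inter_restrict[OF assms(1), of k A] by (simp add: DA)
  have "(\<Prod>e\<in>A. (1 - p e) * h e 0 + p e * h e 1)
        = (\<Prod>e\<in>D. \<Sum>s\<in>{0, 1::real}. bernoulli_weight (p e) s * g e s)"
    unfolding restrict by (rule prod.cong) (auto simp: g_def bernoulli_weight_def)
  also have "\<dots> = (\<Sum>x\<in>D \<rightarrow>\<^sub>E {0, 1}. \<Prod>e\<in>D. bernoulli_weight (p e) (x e) * g e (x e))"
    using assms(1) by (rule prod_sum_PiE) simp
  also have "\<dots> = (\<Sum>x\<in>D \<rightarrow>\<^sub>E {0, 1}. (\<Prod>e\<in>D. bernoulli_weight (p e) (x e)) * (\<Prod>e\<in>A. h e (x e)))"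
    by (rule sum.cong[OF refl]) (simp add: prod.distrib g_def restrict)
  finally show ?thesis by simp
qed

lemma cond_expect_prod:
  assumes "A \<subseteq> aff_edges n"
  shows "cond_expect n \<alpha> \<beta> z (\<lambda>x. \<Prod>e\<in>A. h e (x e))
         = (\<Prod>e\<in>A. (1 - edge_prob \<alpha> \<beta> z e) * h e 0 + edge_prob \<alpha> \<beta> z e * h e 1)"
  unfolding cond_expect_def using bernoulli_expect_prod[OF finite_aff_edges assms] .

lemma cond_expect_shifted_prod:
  assumes "A \<subseteq> aff_edges n"
  shows "cond_expect n \<alpha> \<beta> z (\<lambda>x. \<Prod>e\<in>A. a - x e) = (\<Prod>e\<in>A. a - edge_prob \<alpha> \<beta> z e)"
  using cond_expect_prod[OF assms, of \<alpha> \<beta> z "\<lambda>e s. a - s"] by (simp add: algebra_simps)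

lemma cond_expect_linear:
  assumes "finite I"
  shows "cond_expect n \<alpha> \<beta> z (\<lambda>x. c * f x - (\<Sum>i\<in>I. g i x))
         = c * cond_expect n \<alpha> \<beta> z f - (\<Sum>i\<in>I. cond_expect n \<alpha> \<beta> z (g i))"
proof -
  define w where "w x = (\<Prod>e\<in>aff_edges n. bernoulli_weight (edge_prob \<alpha> \<beta> z e) (x e))" for x
  have "(\<Sum>x\<in>aff_edges n \<rightarrow>\<^sub>E {0, 1}. w x * (c * f x - (\<Sum>i\<in>I. g i x)))
        = (\<Sum>x\<in>aff_edges n \<rightarrow>\<^sub>E {0, 1}. c * (w x * f x) - (\<Sum>i\<in>I. w x * g i x))"
    by (simp add: algebra_simps sum_distrib_left)
  also have "\<dots> = c * (\<Sum>x\<in>aff_edges n \<rightarrow>\<^sub>E {0, 1}. w x * f x)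
                   - (\<Sum>i\<in>I. \<Sum>x\<in>aff_edges n \<rightarrow>\<^sub>E {0, 1}. w x * g i x)"
    by (simp add: sum_subtractf sum_distrib_left sum.swap[of _ I])
  finally show ?thesis unfolding cond_expect_def w_def .
qed

lemma cond_expect_cmult:
  "cond_expect n \<alpha> \<beta> z (\<lambda>x. c * f x) = c * cond_expect n \<alpha> \<beta> z f"
  by (simp add: cond_expect_def sum_distrib_left mult_ac)

lemma cond_expect_edge_times_prod:
  assumes "A \<subseteq> aff_edges n" and "e0 \<in> aff_edges n" and "e0 \<notin> A"
  shows "cond_expect n \<alpha> \<beta> z (\<lambda>x. x e0 * (\<Prod>e\<in>A. a - x e))
         = edge_prob \<alpha> \<beta> z e0 * (\<Prod>e\<in>A. a - edge_prob \<alpha> \<beta> z e)"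
proof -
  define h where "h e s = (if e = e0 then s else a - s)" for e and s :: real
  have fin: "finite A" using assms(1) finite_aff_edges finite_subset by blast
  have "(\<Prod>e\<in>A. h e (x e)) = (\<Prod>e\<in>A. a - x e)" for x :: "nat \<times> nat \<Rightarrow> real"
    by (rule prod.cong) (use assms(3) in \<open>auto simp: h_def\<close>)
  then have "x e0 * (\<Prod>e\<in>A. a - x e) = (\<Prod>e\<in>insert e0 A. h e (x e))" for x
    using assms(3) fin by (simp add: h_def)
  moreover have "(\<Prod>e\<in>A. (1 - edge_prob \<alpha> \<beta> z e) * h e 0 + edge_prob \<alpha> \<beta> z e * h e 1)
      = (\<Prod>e\<in>A. a - edge_prob \<alpha> \<beta> z e)"
    by (rule prod.cong) (use assms(3) in \<open>auto simp: h_def algebra_simps\<close>)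
  then have "(\<Prod>e\<in>insert e0 A. (1 - edge_prob \<alpha> \<beta> z e) * h e 0 + edge_prob \<alpha> \<beta> z e * h e 1)
      = edge_prob \<alpha> \<beta> z e0 * (\<Prod>e\<in>A. a - edge_prob \<alpha> \<beta> z e)"
    using assms(3) fin by (simp add: h_def)
  ultimately show ?thesis
    using cond_expect_prod[of "insert e0 A" n \<alpha> \<beta> z h] assms(1,2) by simp
qed

section \<open>Group assignments\<close>

lemma monochromatic_edge_iff:
  "(\<exists>e\<in>aff_edges n. z (fst e) = z (snd e)) \<longleftrightarrow> \<not> inj_on z {1..n}"
proof
  assume "\<exists>e\<in>aff_edges n. z (fst e) = z (snd e)"
  then obtain i j where "i \<in> {1..n}" "j \<in> {1..n}" "i < j" "z i = z j"
    by (auto simp: aff_edges_def)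
  then show "\<not> inj_on z {1..n}"
    by (metis inj_onD less_irrefl)
next
  assume "\<not> inj_on z {1..n}"
  then obtain i j where ij: "i \<in> {1..n}" "j \<in> {1..n}" "i < j" "z i = z j"
    unfolding inj_on_def by (metis linorder_neqE_nat)
  then have "(i, j) \<in> aff_edges n" by (auto simp: aff_edges_def)
  with ij(4) show "\<exists>e\<in>aff_edges n. z (fst e) = z (snd e)" by force
qed

lemma not_inj_Q_plus_one:
  fixes z :: "nat \<Rightarrow> nat" and Q :: nat
  assumes "z \<in> {1..Q + 1} \<rightarrow>\<^sub>E {1..Q}"
  shows "\<not> inj_on z {1..Q + 1}"
proof (rule pigeonhole)
  have "z ` {1..Q + 1} \<subseteq> {1..Q}" using assms by (auto simp: PiE_iff)
  then have "card (z ` {1..Q + 1}) \<le> Q" using card_mono[of "{1..Q}"] by fastforce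
  then show "card (z ` {1..Q + 1}) < card {1..Q + 1}" by simp
qed

text \<open>The conditional mean of prod_e (alpha - X_e): all factors equal alpha - beta when the
  groups are distinct, and some factor vanishes otherwise.\<close>

lemma prod_alpha_minus_edge_prob:
  "(\<Prod>e\<in>aff_edges n. \<alpha> - edge_prob \<alpha> \<beta> z e)
   = (if inj_on z {1..n} then (\<alpha> - \<beta>) ^ card (aff_edges n) else 0)"
proof (cases "inj_on z {1..n}")
  case True
  then have "\<alpha> - edge_prob \<alpha> \<beta> z e = \<alpha> - \<beta>" if "e \<in> aff_edges n" for e
    using that monochromatic_edge_iff[of n z] by (auto simp: edge_prob_def)
  with True show ?thesis by simp
next
  case False
  then have "\<exists>e\<in>aff_edges n. \<alpha> - edge_prob \<alpha> \<beta> z e = 0"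
    using monochromatic_edge_iff[of n z] by (auto simp: edge_prob_def)
  from prod_zero[OF finite_aff_edges this] False show ?thesis by simp
qed

text \<open>If the first Q nodes are in distinct groups, they occupy all Q groups, so node Q + 1
  shares its group with exactly one of them.\<close>

lemma edge_prob_sum_last_node:
  assumes z: "z \<in> {1..Q + 1} \<rightarrow>\<^sub>E {1..Q}" and inj: "inj_on z {1..Q}"
  shows "(\<Sum>i=1..Q. edge_prob \<alpha> \<beta> z (i, Q + 1)) = \<alpha> + (real Q - 1) * \<beta>"
proof -
  have "z ` {1..Q} = {1..Q}"
    using z inj by (intro endo_inj_surj) (auto simp: PiE_iff)
  moreover have "z (Q + 1) \<in> {1..Q}" using z by (auto simp: PiE_iff)
  ultimately obtain k where k: "k \<in> {1..Q}" "z (Q + 1) = z k" by (metis imageE)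
  have others: "edge_prob \<alpha> \<beta> z (i, Q + 1) = \<beta>" if "i \<in> {1..Q} - {k}" for i
  proof -
    have "z i \<noteq> z k" using that k(1) inj_on_eq_iff[OF inj] by blast
    then show ?thesis using k(2) by (simp add: edge_prob_def)
  qed
  have "(\<Sum>i=1..Q. edge_prob \<alpha> \<beta> z (i, Q + 1))
        = edge_prob \<alpha> \<beta> z (k, Q + 1) + (\<Sum>i\<in>{1..Q} - {k}. edge_prob \<alpha> \<beta> z (i, Q + 1))"
    using k(1) by (simp add: sum.remove)
  also have "(\<Sum>i\<in>{1..Q} - {k}. edge_prob \<alpha> \<beta> z (i, Q + 1)) = (\<Sum>i\<in>{1..Q} - {k}. \<beta>)"
    using others by (rule sum.cong[OF refl])
  also have "edge_prob \<alpha> \<beta> z (k, Q + 1) = \<alpha>" using k(2) by (simp add: edge_prob_def)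
  finally show ?thesis using k(1) by (simp add: of_nat_diff)
qed

text \<open>Given any groups, the integrand of U_Q(alpha) has conditional mean 0, because some
  edge is monochromatic.\<close>

lemma U_conditional_zero:
  assumes "z \<in> {1..Q + 1} \<rightarrow>\<^sub>E {1..Q}"
  shows "cond_expect (Q + 1) \<alpha> \<beta> z (\<lambda>x. \<Prod>e\<in>aff_edges (Q + 1). \<alpha> - x e) = 0"
  using not_inj_Q_plus_one[OF assms]
  by (simp add: cond_expect_shifted_prod prod_alpha_minus_edge_prob)

text \<open>Given any groups, the integrand of V_Q(alpha, beta) has conditional mean 0: expanding
  the linear factor, each term factorises by independence, and the result is
  (alpha + (Q-1) beta - sum_i p_{i,Q+1}) * prod_{i<j<=Q} (alpha - p_ij), which vanishes by
  edge_prob_sum_last_node and prod_alpha_minus_edge_prob.\<close>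

lemma V_conditional_zero:
  assumes z: "z \<in> {1..Q + 1} \<rightarrow>\<^sub>E {1..Q}"
  shows "cond_expect (Q + 1) \<alpha> \<beta> z
           (\<lambda>x. (\<alpha> + (real Q - 1) * \<beta> - (\<Sum>i=1..Q. x (i, Q + 1))) * (\<Prod>e\<in>aff_edges Q. \<alpha> - x e))
         = 0"
proof -
  define c where "c = \<alpha> + (real Q - 1) * \<beta>"
  define T where "T = (\<Prod>e\<in>aff_edges Q. \<alpha> - edge_prob \<alpha> \<beta> z e)"
  have sub: "aff_edges Q \<subseteq> aff_edges (Q + 1)" by (auto simp: aff_edges_def)
  have edge_term: "cond_expect (Q + 1) \<alpha> \<beta> z (\<lambda>x. x (i, Q + 1) * (\<Prod>e\<in>aff_edges Q. \<alpha> - x e))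
                   = edge_prob \<alpha> \<beta> z (i, Q + 1) * T" if "i \<in> {1..Q}" for i
    unfolding T_def using that sub
    by (intro cond_expect_edge_times_prod) (auto simp: aff_edges_def)
  have "cond_expect (Q + 1) \<alpha> \<beta> z
          (\<lambda>x. (c - (\<Sum>i=1..Q. x (i, Q + 1))) * (\<Prod>e\<in>aff_edges Q. \<alpha> - x e))
        = cond_expect (Q + 1) \<alpha> \<beta> z
          (\<lambda>x. c * (\<Prod>e\<in>aff_edges Q. \<alpha> - x e)
               - (\<Sum>i=1..Q. x (i, Q + 1) * (\<Prod>e\<in>aff_edges Q. \<alpha> - x e)))"
    by (rule arg_cong[where f = "cond_expect (Q + 1) \<alpha> \<beta> z"])
      (simp add: fun_eq_iff left_diff_distrib sum_distrib_right)
  also have "\<dots> = c * T - (\<Sum>i=1..Q. edge_prob \<alpha> \<beta> z (i, Q + 1) * T)"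
  proof -
    have "(\<Sum>i=1..Q. cond_expect (Q + 1) \<alpha> \<beta> z (\<lambda>x. x (i, Q + 1) * (\<Prod>e\<in>aff_edges Q. \<alpha> - x e)))
          = (\<Sum>i=1..Q. edge_prob \<alpha> \<beta> z (i, Q + 1) * T)"
      by (rule sum.cong[OF refl]) (rule edge_term)
    then show ?thesis
      unfolding cond_expect_linear[OF finite_atLeastAtMost] cond_expect_shifted_prod[OF sub]
        T_def[symmetric] by (simp only:)
  qed
  also have "\<dots> = (c - (\<Sum>i=1..Q. edge_prob \<alpha> \<beta> z (i, Q + 1))) * T"
    by (simp add: left_diff_distrib sum_distrib_right)
  also have "\<dots> = 0"
    using edge_prob_sum_last_node[OF z]
    by (simp add: T_def c_def prod_alpha_minus_edge_prob)
  finally show ?thesis by (simp add: c_def)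
qed

lemma V_coeff_conditional:
  "cond_expect (Q + 1) \<alpha> \<beta> z (\<lambda>x. (real Q - 1) * (\<Prod>e\<in>aff_edges Q. \<alpha> - x e))
   = (real Q - 1) * (if inj_on z {1..Q} then (\<alpha> - \<beta>) ^ card (aff_edges Q) else 0)"
proof -
  have "aff_edges Q \<subseteq> aff_edges (Q + 1)" by (auto simp: aff_edges_def)
  then show ?thesis
    by (simp add: cond_expect_cmult cond_expect_shifted_prod prod_alpha_minus_edge_prob)
qed

text \<open>With positive group proportions, the first Q nodes lie in distinct groups with
  positive probability (witness: node i in group i).\<close>

lemma prob_distinct_groups_pos:
  assumes "Q \<ge> 1" and pos: "\<forall>q\<in>{1..Q}. 0 < \<pi> q"
  shows "0 < (\<Sum>z\<in>{1..Q + 1} \<rightarrow>\<^sub>E {1..Q}. if inj_on z {1..Q} then prior (Q + 1) \<pi> z else 0)"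
proof (rule sum_pos2)
  define z0 where "z0 = (\<lambda>i\<in>{1..Q + 1}. if i \<le> Q then i else 1)"
  show "finite ({1..Q + 1} \<rightarrow>\<^sub>E {1..Q})" by (simp add: finite_PiE)
  show "z0 \<in> {1..Q + 1} \<rightarrow>\<^sub>E {1..Q}" using assms(1) by (auto simp: z0_def PiE_iff)
  have "inj_on z0 {1..Q}" by (rule inj_onI) (simp add: z0_def)
  moreover have "0 < prior (Q + 1) \<pi> z0"
    unfolding prior_def using assms by (intro prod_pos) (auto simp: z0_def)
  ultimately show "0 < (if inj_on z0 {1..Q} then prior (Q + 1) \<pi> z0 else 0)" by simp
  fix z assume "z \<in> {1..Q + 1} \<rightarrow>\<^sub>E {1..Q}"
  then have "0 \<le> \<pi> (z i)" if "i \<in> {1..Q + 1}" for i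
    using that pos PiE_mem less_imp_le by metis
  then have "0 \<le> prior (Q + 1) \<pi> z"
    unfolding prior_def by (intro prod_nonneg)
  then show "0 \<le> (if inj_on z {1..Q} then prior (Q + 1) \<pi> z else 0)" by simp
qed

lemma card_aff_edges_nonzero:
  assumes "n \<ge> 2"
  shows "card (aff_edges n) \<noteq> 0"
proof -
  have "(1, 2) \<in> aff_edges n" using assms by (simp add: aff_edges_def)
  then show ?thesis using finite_aff_edges[of n] by (auto simp: card_eq_0_iff)
qed

theorem proposition1:
  fixes Q :: nat and \<pi> :: "nat \<Rightarrow> real" and \<alpha> \<beta> :: real
  assumes "Q \<ge> 2"
    and "\<forall>q\<in>{1..Q}. 0 < \<pi> q \<and> \<pi> q < 1"
    and "(\<Sum>q=1..Q. \<pi> q) = 1"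
    and "0 \<le> \<alpha>" "\<alpha> \<le> 1" "0 \<le> \<beta>" "\<beta> \<le> 1"
  shows "poly (U_poly Q \<pi> \<alpha> \<beta>) \<alpha> = 0
       \<and> poly (V_at (V_poly Q \<pi> \<alpha> \<beta>) \<alpha>) \<beta> = 0
       \<and> (coeff (V_at (V_poly Q \<pi> \<alpha> \<beta>) \<alpha>) 1 \<noteq> 0 \<longleftrightarrow> \<alpha> \<noteq> \<beta>)"
proof -
  let ?Z = "{1..Q + 1} \<rightarrow>\<^sub>E {1..Q}"
  have U: "poly (U_poly Q \<pi> \<alpha> \<beta>) \<alpha> = 0"
    unfolding U_eval aff_expect_conditioning
    by (intro sum.neutral ballI) (simp only: U_conditional_zero mult_zero_right)
  have V: "poly (V_at (V_poly Q \<pi> \<alpha> \<beta>) \<alpha>) \<beta> = 0"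
    unfolding V_eval aff_expect_conditioning
    by (intro sum.neutral ballI) (simp only: V_conditional_zero mult_zero_right)
  define P where "P = (\<Sum>z\<in>?Z. if inj_on z {1..Q} then prior (Q + 1) \<pi> z else 0)"
  have coeff_eq: "coeff (V_at (V_poly Q \<pi> \<alpha> \<beta>) \<alpha>) 1
                  = (real Q - 1) * (\<alpha> - \<beta>) ^ card (aff_edges Q) * P"
    unfolding P_def V_coeff_eval aff_expect_conditioning V_coeff_conditional sum_distrib_left
    by (rule sum.cong) auto
  have "P > 0"
    unfolding P_def using assms(1,2) by (intro prob_distinct_groups_pos) auto
  moreover have "real Q - 1 \<noteq> 0" using assms(1) by simp
  moreover have "card (aff_edges Q) \<noteq> 0" using assms(1) by (rule card_aff_edges_nonzero)
  ultimately have "coeff (V_at (V_poly Q \<pi> \<alpha> \<beta>) \<alpha>) 1 \<noteq> 0 \<longleftrightarrow> \<alpha> \<noteq> \<beta>"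
    unfolding coeff_eq by simp
  with U V show ?thesis by blast
qed

end
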